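(* Let $h$ be a positive integer and let $C=(0,1,\dots,h)$. The set of lengths of proper periods of non-zero solutions to the recursion defined by $C$ consists exactly of all positive divisors of $h+1$, except that $1$ is excluded if $h+1$ is odd, and $2$ is excluded if $2\mid h+1$ and $4\nmid h+1$. Moreover, if $h$ is even, then any solution with a period of length $1$ is the zero solution.
   Context: A solution to the recursion defined by a collection of positions $C=(x_1,\dots,x_r)$ (integers $0\le x_1<\dots<x_r$) is an infinite $(0,1)$-sequence $T=(T(0),T(1),\dots)$ such that, with $\delta=x_r-x_1$, $T(i)=\sum_{l=2}^{r}T(i-(x_l-x_1)) \pmod 2$ for all $i\ge\delta$ (the first $\delta$ symbols are arbitrary). Every solution is eventually periodic; a period of $T$ is a non-empty finite word $\pi$ such that $T=\rho\,\pi\pi\pi\cdots$ for some finite (possibly empty) word $\rho$. A period $\pi$ is proper if there is no period $\mu$ with $\pi=\mu^m$, $m>1$. *)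

theory Defs
  imports "HOL-Library.Z2" "HOL-Library.Omega_Words_Fun"
begin

text \<open>
  Infinite \<open>(0,1)\<close>-sequences are functions \<open>nat \<Rightarrow> bit\<close> (that is, \<open>bit word\<close>), so
  addition modulo 2 is the addition of the field \<open>bit\<close>.
\<close>

text \<open>
  A collection of positions \<open>(x\<^sub>1, \<dots>, x\<^sub>r)\<close> is a list of naturals; \<open>x\<^sub>l\<close> is \<open>C ! (l - 1)\<close>.
\<close>

definition positions :: "nat list \<Rightarrow> bool" where
  "positions C \<longleftrightarrow> C \<noteq> [] \<and> sorted_wrt (<) C"

text \<open>
  The recursion, for a list \<open>C\<close> with \<open>positions C\<close>.  Then \<open>last C - hd C\<close> is
  \<open>x\<^sub>r - x\<^sub>1\<close>, and none of the subtractions on \<open>nat\<close> truncates.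
\<close>

definition solution :: "nat list \<Rightarrow> bit word \<Rightarrow> bool" where
  "solution C T \<longleftrightarrow>
     (\<forall>i \<ge> last C - hd C. T i = (\<Sum>l = 1..<length C. T (i - (C ! l - hd C))))"

definition is_period :: "'a list \<Rightarrow> 'a word \<Rightarrow> bool" where
  "is_period p T \<longleftrightarrow> p \<noteq> [] \<and> (\<exists>u. T = u \<frown> p\<^sup>\<omega>)"

definition word_power :: "'a list \<Rightarrow> nat \<Rightarrow> 'a list" where
  "word_power w m = concat (replicate m w)"

definition proper_period :: "'a list \<Rightarrow> 'a word \<Rightarrow> bool" where
  "proper_period p T \<longleftrightarrow>
     is_period p T \<and> \<not> (\<exists>q m. is_period q T \<and> 1 < m \<and> p = word_power q m)"

lemma positions_upt: "positions [0..<h + 1]"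
  by (simp add: positions_def sorted_wrt_upt del: upt_Suc)

end

theory Submission imports Defs begin

text \<open>
  A sequence is a solution iff every window of \<open>h + 1\<close> consecutive terms sums to zero.
  Comparing consecutive windows, solutions are purely \<open>(h + 1)\<close>-periodic; hence any eventual
  period length \<open>d\<close> can be reduced to \<open>gcd d (h + 1)\<close>, and a proper period has length dividing
  \<open>h + 1\<close>.  For \<open>d = 1\<close> and \<open>d = 2\<close> the window sum is \<open>(h + 1) / d\<close> times the sum of one period,
  which yields the exceptions.  Conversely \<open>1\<close>, \<open>10\<close> and \<open>110\<cdots>0\<close> are proper periods.
\<close>

section \<open>The recursion as a condition on windows\<close>

text \<open>Over \<open>bit\<close>, a term equals a sum iff adding the two gives zero. So the
  recursion at index \<open>i + h\<close> says that the window starting at \<open>i\<close> sums to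
  zero.\<close>

lemma solution_upt_iff:
  assumes "h > 0"
  shows "solution [0..<h + 1] T \<longleftrightarrow> (\<forall>i. (\<Sum>j<h + 1. T (i + j)) = 0)"
proof -
  have last: "last [0..<h + 1] = h" and hd: "hd [0..<h + 1] = 0"
    by (simp_all add: hd_append)
  have *: "(T (i + h) = (\<Sum>l = 1..<h + 1. T (i + h - l))) \<longleftrightarrow> (\<Sum>j<h + 1. T (i + j)) = 0" for i
  proof -
    have "(\<Sum>l = 1..<h + 1. T (i + h - l)) = (\<Sum>j<h. T (i + j))"
      by (rule sum.reindex_bij_witness[where i = "\<lambda>j. h - j" and j = "\<lambda>l. h - l"]) auto
    then show ?thesis
      by (cases "T (i + h)"; cases "\<Sum>j<h. T (i + j)") simp_all
  qed
  have "solution [0..<h + 1] T \<longleftrightarrow> (\<forall>i\<ge>h. T i = (\<Sum>l = 1..<h + 1. T (i - l)))"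
    unfolding solution_def last hd by (simp del: upt_Suc)
  also have "\<dots> \<longleftrightarrow> (\<forall>i. T (i + h) = (\<Sum>l = 1..<h + 1. T (i + h - l)))"
    by (metis le_add2 le_add_diff_inverse2)
  finally show ?thesis
    using * by simp
qed

section \<open>Periods and word powers, letter by letter\<close>

text \<open>Only the length \<open>N\<close> of the preperiod matters: its letters can be read off
  \<open>T\<close> as \<open>prefix N T\<close>.\<close>

lemma is_period_iff:
  "is_period p T \<longleftrightarrow> p \<noteq> [] \<and> (\<exists>N. \<forall>i. T (N + i) = p ! (i mod length p))"
proof
  assume "is_period p T"
  then obtain u where "p \<noteq> []" "T = u \<frown> p\<^sup>\<omega>"
    unfolding is_period_def by blast
  then have "\<forall>i. T (length u + i) = p ! (i mod length p)"
    by (simp add: conc_def iter_def)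
  with \<open>p \<noteq> []\<close> show "p \<noteq> [] \<and> (\<exists>N. \<forall>i. T (N + i) = p ! (i mod length p))"
    by blast
next
  assume "p \<noteq> [] \<and> (\<exists>N. \<forall>i. T (N + i) = p ! (i mod length p))"
  then obtain N where p: "p \<noteq> []" and N: "\<And>i. T (N + i) = p ! (i mod length p)"
    by blast
  have "T = prefix N T \<frown> p\<^sup>\<omega>"
  proof
    fix i show "T i = (prefix N T \<frown> p\<^sup>\<omega>) i"
      using N[of "i - N"] p by (cases "i < N") (simp_all add: conc_def iter_def)
  qed
  with p show "is_period p T"
    unfolding is_period_def by blast
qed

lemma length_word_power: "length (word_power q m) = m * length q"
  by (simp add: word_power_def length_concat sum_list_replicate)

lemma nth_word_power:
  "i < m * length q \<Longrightarrow> word_power q m ! i = q ! (i mod length q)"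
proof (induction m arbitrary: i)
  case (Suc m)
  then show ?case
    by (cases "i < length q") (auto simp: word_power_def nth_append le_mod_geq)
qed simp

section \<open>Shift-invariant sequences and their sums\<close>

lemma periodic_mult:
  fixes T :: "nat \<Rightarrow> 'a"
  assumes "\<And>i. T (i + d) = T i"
  shows "T (i + k * d) = T i"
proof (induction k)
  case (Suc k)
  then show ?case
    using assms[of "i + k * d"] by (simp add: algebra_simps)
qed simp

lemma periodic_mod:
  fixes T :: "nat \<Rightarrow> 'a"
  assumes "\<And>i. T (i + d) = T i"
  shows "T i = T (i mod d)"
  using periodic_mult[of T d "i mod d" "i div d", OF assms] by simp

text \<open>Bezout in the subtraction-free form \<open>a * x = b * y + gcd a b\<close>: a shift by
  the gcd followed by \<open>y\<close> shifts by \<open>b\<close> amounts to \<open>x\<close> shifts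
  by \<open>a\<close>.\<close>

lemma periodic_gcd:
  fixes T :: "nat \<Rightarrow> 'a"
  assumes a: "\<And>i. T (i + a) = T i" and b: "\<And>i. T (i + b) = T i" and "a \<noteq> 0"
  shows "T (i + gcd a b) = T i"
proof -
  obtain x y where xy: "a * x = b * y + gcd a b"
    using bezout_nat[OF \<open>a \<noteq> 0\<close>] by blast
  have "T (i + gcd a b) = T (i + gcd a b + y * b)"
    using periodic_mult[of T b, OF b] by simp
  also have "i + gcd a b + y * b = i + x * a"
    using xy by (simp add: algebra_simps)
  also have "T \<dots> = T i"
    using periodic_mult[of T a, OF a] by simp
  finally show ?thesis .
qed

text \<open>The sum splits into \<open>k\<close> equal blocks. In type \<open>bit\<close> the factor
  \<open>of_nat k\<close> is the parity of \<open>k\<close>, on which the exceptional lengths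
  depend.\<close>

lemma sum_periodic:
  fixes T :: "nat \<Rightarrow> 'a::semiring_1"
  assumes "\<And>i. T (i + d) = T i"
  shows "(\<Sum>j<k * d. T j) = of_nat k * (\<Sum>j<d. T j)"
proof -
  have "(\<Sum>j = m * d..<m * d + d. T j) = (\<Sum>j<d. T j)" for m
  proof -
    have "(\<Sum>j = m * d..<m * d + d. T j) = (\<Sum>j<d. T (j + m * d))"
      using sum.shift_bounds_nat_ivl[of T 0 "m * d" d] by (simp add: add.commute atLeast0LessThan)
    then show ?thesis
      using periodic_mult[of T d, OF assms] by simp
  qed
  then show ?thesis
    using sum.nat_group[of T d k] by simp
qed

text \<open>Moving the window one step exchanges \<open>T i\<close> for the equal term
  \<open>T (i + n)\<close>.\<close>

lemma sum_shift_periodic: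
  fixes T :: "nat \<Rightarrow> 'a::ab_group_add"
  assumes "\<And>i. T (i + n) = T i"
  shows "(\<Sum>j<n. T (i + j)) = (\<Sum>j<n. T j)"
proof (induction i)
  case (Suc i)
  have "(\<Sum>j<Suc n. T (i + j)) = T i + (\<Sum>j<n. T (Suc i + j))"
    by (simp only: sum.lessThan_Suc_shift) simp
  then show ?case
    using Suc assms[of i] by (simp add: add.commute)
qed simp

section \<open>Solutions and their proper periods\<close>

text \<open>Consecutive windows differ only in their end terms, so if both sums vanish the end terms
  agree. Conversely, periodicity makes all window sums equal, and the first one decides.\<close>

lemma solution_upt_iff_periodic:
  assumes "h > 0"
  shows "solution [0..<h + 1] T \<longleftrightarrow>
           (\<forall>i. T (i + (h + 1)) = T i) \<and> (\<Sum>j<h + 1. T j) = 0"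
proof
  assume "solution [0..<h + 1] T"
  then have *: "(\<Sum>j<h + 1. T (i + j)) = 0" for i
    using solution_upt_iff[OF assms] by blast
  have "T (i + (h + 1)) = T i" for i
  proof -
    have "(\<Sum>j<Suc (h + 1). T (i + j)) = T i + (\<Sum>j<h + 1. T (Suc i + j))"
      by (simp only: sum.lessThan_Suc_shift) simp
    moreover have "(\<Sum>j<Suc (h + 1). T (i + j)) = (\<Sum>j<h + 1. T (i + j)) + T (i + (h + 1))"
      by (rule sum.lessThan_Suc)
    ultimately show ?thesis
      unfolding * by (metis add_0_left add_0_right)
  qed
  with *[of 0] show "(\<forall>i. T (i + (h + 1)) = T i) \<and> (\<Sum>j<h + 1. T j) = 0"
    by simp
next
  assume "(\<forall>i. T (i + (h + 1)) = T i) \<and> (\<Sum>j<h + 1. T j) = 0"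
  then show "solution [0..<h + 1] T"
    unfolding solution_upt_iff[OF assms] using sum_shift_periodic[of T "h + 1"] by metis
qed

text \<open>An eventual period holds from the start: a multiple of \<open>n\<close> carries any
  index past the preperiod without changing the value.\<close>

lemma is_period_purely_periodic:
  assumes n: "\<And>i. T (i + n) = T i" and "n > 0" and "is_period p T"
  shows "T (i + length p) = T i"
proof -
  obtain N where N: "\<And>i. T (N + i) = p ! (i mod length p)"
    using assms(3) is_period_iff by blast
  have "N \<le> i + N * n"
    using \<open>n > 0\<close> by (simp add: trans_le_add2)
  then obtain k where k: "i + N * n = N + k"
    using le_Suc_ex by blast
  have "T (i + length p) = T (i + length p + N * n)"
    using periodic_mult[of T n, OF n] by simp
  also have "i + length p + N * n = N + (k + length p)"
    using k by simp
  also have "T \<dots> = T (N + k)"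
    by (simp only: N) simp
  also have "\<dots> = T i"
    using periodic_mult[of T n, OF n] k by metis
  finally show ?thesis .
qed

text \<open>If \<open>m > 1\<close>, the first \<open>g\<close> letters of \<open>p\<close> would
  form a period whose \<open>m\<close>-th power is \<open>p\<close>.\<close>

lemma proper_period_not_refinable:
  assumes "proper_period p T" and g: "\<And>i. T (i + g) = T i" and len: "length p = m * g"
  shows "m = 1"
proof (rule ccontr)
  assume "m \<noteq> 1"
  have per: "is_period p T" and
    proper: "\<And>q m. is_period q T \<Longrightarrow> 1 < m \<Longrightarrow> p \<noteq> word_power q m"
    using assms(1) unfolding proper_period_def by blast+
  obtain N where "p \<noteq> []" and N: "\<And>i. T (N + i) = p ! (i mod length p)"
    using per is_period_iff by blast
  have pos: "m > 0" "g > 0"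
    using \<open>p \<noteq> []\<close> len by (auto intro: gr0I)
  then have "m > 1"
    using \<open>m \<noteq> 1\<close> by linarith
  have "g \<le> length p"
    using len pos by simp
  define q where "q = take g p"
  have len_q: "length q = g"
    using \<open>g \<le> length p\<close> by (simp add: q_def)
  have q: "T (N + i) = q ! (i mod g)" for i
  proof -
    have "T (N + i) = T (N + i mod g)"
      using periodic_mod[of "\<lambda>i. T (N + i)" g i] g by (simp add: add.assoc[symmetric])
    moreover have "i mod g < length p"
      using pos \<open>g \<le> length p\<close> by (meson mod_less_divisor order_less_le_trans)
    ultimately show ?thesis
      using N[of "i mod g"] pos by (simp add: q_def)
  qed
  then have "is_period q T"
    using is_period_iff[of q T] len_q pos by auto
  moreover have "p = word_power q m"
  proof (rule nth_equalityI)
    show "length p = length (word_power q m)"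
      by (simp add: length_word_power len_q len)
    fix i assume "i < length p"
    then show "p ! i = word_power q m ! i"
      using N[of i] q[of i] len by (simp add: nth_word_power len_q)
  qed
  ultimately show False
    using proper \<open>m > 1\<close> by blast
qed

section \<open>Restrictions on the length\<close>

text \<open>A constant sequence has window sum \<open>of_nat (h + 1) * T 0\<close>, which is
  \<open>T 0\<close> because \<open>h + 1\<close> is odd.\<close>

lemma solution_period_1_eq_0:
  assumes "even h" "h > 0" "solution [0..<h + 1] T" "is_period p T" "length p = 1"
  shows "T = (\<lambda>_. 0)"
proof -
  have n: "\<And>i. T (i + (h + 1)) = T i" and s: "(\<Sum>j<h + 1. T j) = 0"
    using assms(3) solution_upt_iff_periodic[OF assms(2)] by blast+
  have 1: "T (i + 1) = T i" for i
    using is_period_purely_periodic[of T "h + 1" p, OF n _ assms(4)] assms(5) by simp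
  have "of_nat (h + 1) * T 0 = 0"
    using sum_periodic[of T 1 "h + 1", OF 1] s by simp
  moreover have "of_nat (h + 1) = (1 :: bit)"
    using \<open>even h\<close> by (auto elim!: evenE)
  ultimately have "T 0 = 0"
    by simp
  then show ?thesis
    using periodic_mod[of T 1, OF 1] by auto
qed

text \<open>Both \<open>length p\<close> and \<open>h + 1\<close> are shifts fixing
  \<open>T\<close>, hence so is their gcd \<open>g\<close>; properness forces \<open>g\<close> to be
  \<open>length p\<close>.\<close>

lemma proper_period_length:
  assumes "h > 0" and sol: "solution [0..<h + 1] T" and "T \<noteq> (\<lambda>_. 0)" and pp: "proper_period p T"
  shows "length p > 0 \<and> length p dvd h + 1 \<and> \<not> (length p = 1 \<and> odd (h + 1))
           \<and> \<not> (length p = 2 \<and> 2 dvd h + 1 \<and> \<not> 4 dvd h + 1)"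
proof -
  have n: "\<And>i. T (i + (h + 1)) = T i" and s: "(\<Sum>j<h + 1. T j) = 0"
    using sol solution_upt_iff_periodic[OF \<open>h > 0\<close>] by blast+
  have per: "is_period p T"
    using pp proper_period_def by blast
  then have pos: "length p > 0"
    using is_period_iff by blast
  have d: "T (i + length p) = T i" for i
    using is_period_purely_periodic[of T "h + 1" p, OF n _ per] by simp
  define g where "g = gcd (length p) (h + 1)"
  have "T (i + g) = T i" for i
    unfolding g_def using periodic_gcd[of T, OF d n] pos by blast
  moreover obtain m where m: "length p = m * g"
    unfolding g_def by (metis gcd_dvd1 dvd_def mult.commute)
  ultimately have "m = 1"
    using proper_period_not_refinable[OF pp] by blast
  then have "length p dvd h + 1"
    using m g_def gcd_dvd2 by (metis mult_1)
  moreover have "\<not> (length p = 1 \<and> odd (h + 1))"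
    using solution_period_1_eq_0[OF _ \<open>h > 0\<close> sol per] \<open>T \<noteq> (\<lambda>_. 0)\<close> by auto
  moreover have "4 dvd h + 1" if "length p = 2" "2 dvd h + 1"
  proof (rule ccontr)
    assume "\<not> 4 dvd h + 1"
    obtain k where k: "h + 1 = k * 2"
      using \<open>2 dvd h + 1\<close> by (metis dvd_def mult.commute)
    \<comment> \<open>With \<open>k\<close> odd, the window sum is the sum of a single period,
      \<open>T 0 + T 1\<close>. Its vanishing makes \<open>T\<close> constant, so a period of length
      2 is not proper.\<close>
    have "odd k"
      using k \<open>\<not> 4 dvd h + 1\<close> by (auto elim!: evenE)
    then have "of_nat k = (1 :: bit)"
      by (auto elim!: oddE)
    moreover have 2: "T (i + 2) = T i" for i
      using d that by simp
    then have "(\<Sum>j<k * 2. T j) = of_nat k * (\<Sum>j<2. T j)"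
      by (rule sum_periodic)
    moreover have "(\<Sum>j<2. T j) = T 0 + T 1"
      by (simp add: numeral_2_eq_2)
    ultimately have "T 0 + T 1 = 0"
      using s unfolding k by (metis mult_1)
    then have eq: "T 1 = T 0"
      by (cases "T 0"; cases "T 1") simp_all
    have "T i = T 0" for i
      using periodic_mod[of T 2 i, OF 2] eq by (cases "even i") (auto simp: odd_iff_mod_2_eq_one)
    then have "T (i + 1) = T i" for i
      by metis
    from proper_period_not_refinable[of p T 1 2, OF pp this] that show False
      by simp
  qed
  ultimately show ?thesis
    using pos by blast
qed

section \<open>Construction for each remaining length\<close>

lemma proper_period_exists:
  assumes "h > 0" "d > 0" "d dvd h + 1" and 1: "\<not> (d = 1 \<and> odd (h + 1))"
    and 2: "\<not> (d = 2 \<and> 2 dvd h + 1 \<and> \<not> 4 dvd h + 1)"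
  shows "\<exists>p T. solution [0..<h + 1] T \<and> T \<noteq> (\<lambda>_. 0) \<and> proper_period p T \<and> length p = d"
proof -
  \<comment> \<open>For \<open>d \<ge> 3\<close> one period contains two ones, so its sum vanishes
    for every \<open>k\<close>. For \<open>d = 1\<close> or \<open>d = 2\<close> it contains a
    single one, and \<open>k\<close> must be even.\<close>
  define f :: "nat \<Rightarrow> bit" where "f j = (if j = 0 \<or> j = 1 \<and> d \<ge> 3 then 1 else 0)" for j
  define T where "T i = f (i mod d)" for i
  define p where "p = map f [0..<d]"
  have len: "length p = d"
    by (simp add: p_def)
  obtain k where k: "h + 1 = k * d"
    using \<open>d dvd h + 1\<close> by (metis dvd_def mult.commute)
  have per: "T (i + d) = T i" for i
    by (simp add: T_def)
  have "of_nat k * (\<Sum>j<d. T j) = 0"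
  proof -
    consider "d = 1" | "d = 2" | e where "d = e + 3"
      using \<open>d > 0\<close> by (metis One_nat_def add.commute less_2_cases_iff not_less_eq
          numeral_3_eq_3 numeral_2_eq_2 le_Suc_ex not_less less_antisym neq0_conv)
    then show ?thesis
    proof cases
      case 1
      then show ?thesis
        using k assms(4) by (auto elim!: evenE)
    next
      case 2
      \<comment> \<open>Here \<open>h + 1 = 2 * k\<close>, and the excluded case leaves
        \<open>4 dvd h + 1\<close>.\<close>
      then have "even k"
        using k assms(5) by (auto elim!: oddE)
      then show ?thesis
        by (auto elim!: evenE)
    next
      case 3
      have "(\<Sum>j<d. T j) = (\<Sum>j<d. f j)"
        by (simp add: T_def)
      also have "\<dots> = (\<Sum>j\<in>{0, 1}. f j)"
        by (rule sum.mono_neutral_right) (auto simp: f_def 3)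
      also have "\<dots> = 0"
        by (simp add: f_def 3)
      finally show ?thesis
        by simp
    qed
  qed
  then have "(\<Sum>j<h + 1. T j) = 0"
    using sum_periodic[of T d k, OF per] k by simp
  moreover have "T (i + (h + 1)) = T i" for i
    using periodic_mult[of T d i k, OF per] k by simp
  ultimately have "solution [0..<h + 1] T"
    using solution_upt_iff_periodic[OF \<open>h > 0\<close>] by blast
  moreover have "T 0 \<noteq> 0"
    by (simp add: T_def f_def)
  then have "T \<noteq> (\<lambda>_. 0)"
    by metis
  moreover have "proper_period p T"
    unfolding proper_period_def
  proof (intro conjI notI)
    have "\<forall>i. T (0 + i) = p ! (i mod length p)"
      using \<open>d > 0\<close> by (simp add: p_def T_def)
    then show "is_period p T"
      unfolding is_period_iff using \<open>d > 0\<close> len by (metis length_greater_0_conv)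
  next
    assume "\<exists>q m. is_period q T \<and> 1 < m \<and> p = word_power q m"
    then obtain q m where "1 < m" and p: "p = word_power q m"
      by blast
    have d: "d = m * length q"
      using p len length_word_power by metis
    then have "length q > 0"
      using \<open>d > 0\<close> by (metis mult_0_right neq0_conv)
    then have "length q < d"
      using d \<open>1 < m\<close> by simp
    have f: "f i = q ! (i mod length q)" if "i < d" for i
    proof -
      have "f i = p ! i"
        using that by (simp add: p_def)
      also have "\<dots> = q ! (i mod length q)"
        unfolding p using that d by (intro nth_word_power) simp
      finally show ?thesis .
    qed
    \<comment> \<open>A repetition of \<open>q\<close> puts a second one at index
      \<open>length q\<close>. The only positive index where \<open>f\<close> is 1 is 1, and only if
      \<open>d \<ge> 3\<close>; then \<open>q\<close> is a single letter, contradicting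
      \<open>f 2 = 0\<close>.\<close>
    have "f (length q) = f 0"
      using f \<open>length q < d\<close> by simp
    then have "length q = 1" "d \<ge> 3"
      using \<open>length q > 0\<close> by (auto simp: f_def split: if_splits)
    then have "f 2 = f 0"
      using f by simp
    then show False
      by (simp add: f_def)
  qed
  ultimately show ?thesis
    using len by blast
qed

theorem theorem2:
  fixes h :: nat
  assumes "h > 0"
  shows "{length p | p T. solution [0..<h + 1] T \<and> T \<noteq> (\<lambda>_. 0) \<and> proper_period p T}
           = {d. d > 0 \<and> d dvd h + 1 \<and> \<not> (d = 1 \<and> odd (h + 1))
                 \<and> \<not> (d = 2 \<and> 2 dvd h + 1 \<and> \<not> 4 dvd h + 1)}
         \<and> (even h \<longrightarrow>
             (\<forall>T. solution [0..<h + 1] T \<and> (\<exists>p. is_period p T \<and> length p = 1)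
                \<longrightarrow> T = (\<lambda>_. 0)))"
    (is "?A = ?B \<and> _")
proof (intro conjI impI allI)
  show "?A = ?B"
  proof (intro set_eqI iffI)
    fix d assume "d \<in> ?A"
    then obtain p T where "d = length p" "solution [0..<h + 1] T" "T \<noteq> (\<lambda>_. 0)" "proper_period p T"
      unfolding mem_Collect_eq by (elim exE conjE)
    then show "d \<in> ?B"
      unfolding mem_Collect_eq using proper_period_length[OF assms] by metis
  next
    fix d assume "d \<in> ?B"
    then have "\<exists>p T. solution [0..<h + 1] T \<and> T \<noteq> (\<lambda>_. 0) \<and> proper_period p T \<and> length p = d"
      unfolding mem_Collect_eq by (elim conjE) (rule proper_period_exists[OF assms])
    then show "d \<in> ?A"
      unfolding mem_Collect_eq by metis
  qed
next
  fix T assume "even h" and T: "solution [0..<h + 1] T \<and> (\<exists>p. is_period p T \<and> length p = 1)"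
  from T obtain p where "solution [0..<h + 1] T" "is_period p T" "length p = 1"
    by (elim exE conjE)
  with \<open>even h\<close> show "T = (\<lambda>_. 0)"
    using solution_period_1_eq_0[OF _ assms] by metis
qed

end
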